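(* Let $W:\Omega^2\to[0,1]$ be a graphon and $F$ an arbitrary finite graph. Then $\mathsf{til}(F,W)=\mathsf{fcov}(F,W)$.
   Context: $(\Omega,\nu)$ is an atomless Borel probability space; a graphon is a symmetric measurable $W:\Omega^2\to[0,1]$. Let $F$ have vertex set $[k]$; $W^{\otimes F}(x_1,\dots,x_k)=\prod_{ij\in E(F),i<j}W(x_i,x_j)$ and $\mathcal{F}_F(W)=\{W^{\otimes F}\neq0\}$. An $F$-tiling in $W$ is a measurable $\mathfrak{t}:\Omega^k\to[0,\infty)$ with $\{\mathfrak{t}\neq0\}\subset\mathcal{F}_F(W)$ such that for each $x\in\Omega$, $\sum_{\ell=1}^k\int\mathfrak{t}(x_1,\dots,x_{\ell-1},x,x_{\ell+1},\dots,x_k)\,\mathrm{d}\nu^{k-1}\le1$ (integrating over all coordinates except the $\ell$-th); its size is $\int\mathfrak{t}\,\mathrm{d}\nu^k$, and $\mathsf{til}(F,W)$ is the supremum of sizes. A fractional $F$-cover of $W$ is a measurable $\mathfrak{c}:\Omega\to[0,1]$ with $\nu^k\big(\mathcal{F}_F(W)\cap\{(x_1,\dots,x_k):\sum_{i=1}^k\mathfrak{c}(x_i)<1\}\big)=0$; its size is $\int\mathfrak{c}\,\mathrm{d}\nu$, and $\mathsf{fcov}(F,W)$ is the infimum of sizes. *)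

theory Defs
  imports "HOL-Analysis.Analysis" "HOL-Probability.Probability"
begin

definition atomless :: "'a measure \<Rightarrow> bool" where
  "atomless M \<longleftrightarrow> (\<forall>A\<in>sets M. 0 < emeasure M A \<longrightarrow>
      (\<exists>B\<in>sets M. B \<subseteq> A \<and> 0 < emeasure M B \<and> emeasure M B < emeasure M A))"

definition graphon :: "'a measure \<Rightarrow> ('a \<Rightarrow> 'a \<Rightarrow> real) \<Rightarrow> bool" where
  "graphon M W \<longleftrightarrow> (\<lambda>(x,y). W x y) \<in> borel_measurable (M \<Otimes>\<^sub>M M)
     \<and> (\<forall>x y. W x y = W y x) \<and> (\<forall>x y. 0 \<le> W x y \<and> W x y \<le> 1)"

definition simple_graph :: "nat \<Rightarrow> (nat \<times> nat) set \<Rightarrow> bool" where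
  "simple_graph k E \<longleftrightarrow> E \<subseteq> {0..<k} \<times> {0..<k} \<and> (\<forall>i j. (i,j) \<in> E \<longrightarrow> (j,i) \<in> E)
     \<and> (\<forall>i. (i,i) \<notin> E)"

abbreviation PiOmega :: "'a measure \<Rightarrow> nat set \<Rightarrow> (nat \<Rightarrow> 'a) measure" where
  "PiOmega M I \<equiv> PiM I (\<lambda>_. M)"

definition homprod :: "nat \<Rightarrow> (nat \<times> nat) set \<Rightarrow> ('a \<Rightarrow> 'a \<Rightarrow> real) \<Rightarrow> (nat \<Rightarrow> 'a) \<Rightarrow> real" where
  "homprod k E W x = (\<Prod>(i,j)\<in>{(i,j)\<in>E. i < j}. W (x i) (x j))"

definition copy_set :: "'a measure \<Rightarrow> nat \<Rightarrow> (nat \<times> nat) set \<Rightarrow> ('a \<Rightarrow> 'a \<Rightarrow> real) \<Rightarrow> (nat \<Rightarrow> 'a) set" where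
  "copy_set M k E W = {x \<in> space (PiOmega M {0..<k}). homprod k E W x \<noteq> 0}"

definition is_tiling :: "'a measure \<Rightarrow> nat \<Rightarrow> (nat \<times> nat) set \<Rightarrow> ('a \<Rightarrow> 'a \<Rightarrow> real)
    \<Rightarrow> ((nat \<Rightarrow> 'a) \<Rightarrow> real) \<Rightarrow> bool" where
  "is_tiling M k E W t \<longleftrightarrow>
     t \<in> borel_measurable (PiOmega M {0..<k})
   \<and> (\<forall>x\<in>space (PiOmega M {0..<k}). 0 \<le> t x)
   \<and> {x \<in> space (PiOmega M {0..<k}). t x \<noteq> 0} \<subseteq> copy_set M k E W
   \<and> (\<forall>x\<in>space M. (\<Sum>l<k. \<integral>\<^sup>+ y. ennreal (t (y(l := x))) \<partial>PiOmega M ({0..<k} - {l})) \<le> 1)"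

definition til :: "'a measure \<Rightarrow> nat \<Rightarrow> (nat \<times> nat) set \<Rightarrow> ('a \<Rightarrow> 'a \<Rightarrow> real) \<Rightarrow> ennreal" where
  "til M k E W = (SUP t\<in>{t. is_tiling M k E W t}. \<integral>\<^sup>+ x. ennreal (t x) \<partial>PiOmega M {0..<k})"

definition is_fcover :: "'a measure \<Rightarrow> nat \<Rightarrow> (nat \<times> nat) set \<Rightarrow> ('a \<Rightarrow> 'a \<Rightarrow> real)
    \<Rightarrow> ('a \<Rightarrow> real) \<Rightarrow> bool" where
  "is_fcover M k E W c \<longleftrightarrow>
     c \<in> borel_measurable M
   \<and> (\<forall>x\<in>space M. 0 \<le> c x \<and> c x \<le> 1)
   \<and> emeasure (PiOmega M {0..<k}) (copy_set M k E W \<inter> {x. (\<Sum>i<k. c (x i)) < 1}) = 0"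

definition fcov :: "'a measure \<Rightarrow> nat \<Rightarrow> (nat \<times> nat) set \<Rightarrow> ('a \<Rightarrow> 'a \<Rightarrow> real) \<Rightarrow> ennreal" where
  "fcov M k E W = (INF c\<in>{c. is_fcover M k E W c}. \<integral>\<^sup>+ x. ennreal (c x) \<partial>M)"

end

theory Submission
  imports Defs
begin

text \<open>
  Weak duality is Fubini. For the converse, relax the covering constraint to a penalty: let
  \<open>c\<close> minimise \<open>\<integral>c + n \<integral>\<^sub>F (max 0 (1 - \<Sum>\<^sub>i c(x\<^sub>i)))\<^sup>2\<close> over all measurable \<open>c\<close> with values
  in \<open>[0,1]\<close>. The first-order conditions say exactly that the derivative of the penalty,
  \<open>t = 2 n max 0 (1 - \<Sum>\<^sub>i c(x\<^sub>i))\<close> on \<open>F\<close>, has marginal sum at most 1 almost everywhere and that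
  \<open>\<integral>c \<le> \<integral> t \<Sum>\<^sub>i c(x\<^sub>i) \<le> \<integral>t\<close>; so, after a change on a null set, \<open>t\<close> is a tiling at least as large
  as \<open>c\<close>. The penalty of \<open>c\<close> is at most \<open>1/n\<close>, hence in the limit \<open>n \<rightarrow> \<infinity>\<close> one obtains a cover
  whose size is at most the supremum of the tiling sizes.
\<close>

section \<open>Functions with values in [0,1] and almost everywhere limits\<close>

definition unit_funs :: "'a measure \<Rightarrow> ('a \<Rightarrow> real) set" where
  "unit_funs M = {f \<in> borel_measurable M. \<forall>x\<in>space M. 0 \<le> f x \<and> f x \<le> 1}"

lemma unit_funs_measurable [measurable_dest]: "f \<in> unit_funs M \<Longrightarrow> f \<in> borel_measurable M"
  by (simp add: unit_funs_def)

lemma unit_funsD: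
  assumes "f \<in> unit_funs M" "x \<in> space M"
  shows "0 \<le> f x" "f x \<le> 1"
  using assms by (auto simp: unit_funs_def)

lemma unit_funs_midpoint:
  assumes "f \<in> unit_funs M" "g \<in> unit_funs M"
  shows "(\<lambda>x. (f x + g x) / 2) \<in> unit_funs M"
  using assms by (auto simp: unit_funs_def) (smt (verit) field_sum_of_halves)+

lemma (in prob_space) unit_funs_integrable:
  assumes "f \<in> unit_funs M"
  shows "integrable M f"
  using assms by (intro integrable_const_bound[where B=1] AE_I2) (auto simp: unit_funs_def)

lemma (in prob_space) unit_funs_integrable_square:
  assumes "f \<in> unit_funs M"
  shows "integrable M (\<lambda>x. (f x)\<^sup>2)"
  using assms
  by (intro integrable_const_bound[where B=1] AE_I2) (auto simp: unit_funs_def power_le_one)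

text \<open>On a probability space a Cauchy sequence in L2 is Cauchy in L1, and some subsequence of
  it converges almost everywhere. Almost everywhere convergence is the mode wanted later, because
  dominated convergence then carries it through the nonlinear penalty.\<close>

lemma (in prob_space) integral_square_Cauchy_AE_limit:
  assumes f: "\<And>n. f n \<in> unit_funs M"
    and d: "\<And>N i j. N \<le> i \<Longrightarrow> N \<le> j \<Longrightarrow> (\<integral>x. (f i x - f j x)\<^sup>2 \<partial>M) \<le> d N"
    and d0: "d \<longlonglongrightarrow> (0::real)"
  obtains r g where "strict_mono r" "g \<in> unit_funs M" "AE x in M. (\<lambda>n. f (r n) x) \<longlonglongrightarrow> g x"
proof -
  note f[THEN unit_funs_measurable, measurable]
  have sq: "integrable M (\<lambda>x. (f i x - f j x)\<^sup>2)" for i j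
  proof (intro integrable_const_bound[where B=1] AE_I2)
    fix x assume "x \<in> space M"
    then have "\<bar>f i x - f j x\<bar> \<le> 1"
      using unit_funsD[OF f, of x i] unit_funsD[OF f, of x j] by linarith
    then show "norm ((f i x - f j x)\<^sup>2) \<le> 1"
      by (simp add: abs_square_le_1)
  qed measurable
  obtain r where r: "strict_mono r" "AE x in M. Cauchy (\<lambda>i. f (r i) x)"
  proof (rule cauchy_L1_AE_cauchy_subseq[of M f])
    show "integrable M (f n)" for n
      by (rule unit_funs_integrable[OF f])
    fix e :: real assume e: "e > 0"
    then have "\<forall>\<^sub>F n in sequentially. d n < e\<^sup>2"
      by (intro order_tendstoD(2)[OF d0]) auto
    then obtain N where N: "d N < e\<^sup>2"
      by (auto simp: eventually_sequentially)
    have "(\<integral>x. norm (f i x - f j x) \<partial>M) < e" if "i \<ge> N" "j \<ge> N" for i j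
    proof -
      \<comment> \<open>AM-GM in the form \<open>\<bar>u\<bar> \<le> e/2 + u^2/(2*e)\<close>. The
        choice \<open>d N < e^2\<close> makes the second term integrate to less than
        \<open>e/2\<close>.\<close>
      have "(\<integral>x. norm (f i x - f j x) \<partial>M) \<le> (\<integral>x. e/2 + (f i x - f j x)\<^sup>2 / (2*e) \<partial>M)"
      proof (intro integral_mono)
        fix x
        have "0 \<le> (\<bar>f i x - f j x\<bar> - e)\<^sup>2" by simp
        then show "norm (f i x - f j x) \<le> e/2 + (f i x - f j x)\<^sup>2 / (2*e)"
          using e by (simp add: field_simps power2_eq_square abs_mult_self_eq)
      qed (use sq unit_funs_integrable[OF f] in auto)
      also have "\<dots> = e/2 + (\<integral>x. (f i x - f j x)\<^sup>2 \<partial>M) / (2*e)"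
        using sq by (simp add: prob_space)
      also have "\<dots> \<le> e/2 + d N / (2*e)"
        using d[OF that] e by (simp add: divide_right_mono)
      also have "\<dots> < e"
        using N e by (simp add: field_simps power2_eq_square)
      finally show ?thesis .
    qed
    then show "\<exists>N. \<forall>i\<ge>N. \<forall>j\<ge>N. (\<integral>x. norm (f i x - f j x) \<partial>M) < e"
      by blast
  qed
  \<comment> \<open>Clipping puts \<open>g\<close> into \<open>unit_funs M\<close> even at points
    where the sequence diverges and \<open>lim\<close> is unspecified; at points of convergence it
    changes nothing.\<close>
  define g where "g x = max 0 (min 1 (lim (\<lambda>n. f (r n) x)))" for x
  have "g \<in> unit_funs M"
    unfolding g_def unit_funs_def by auto
  moreover have "AE x in M. (\<lambda>n. f (r n) x) \<longlonglongrightarrow> g x"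
    using r(2) AE_space
  proof eventually_elim
    case (elim x)
    then obtain l where l: "(\<lambda>n. f (r n) x) \<longlonglongrightarrow> l"
      by (auto simp: Cauchy_convergent_iff convergent_def)
    have "0 \<le> l" "l \<le> 1"
      using LIMSEQ_le_const[OF l, of 0] LIMSEQ_le_const2[OF l, of 1] unit_funsD[OF f elim(2)]
      by auto
    then show ?case
      using l by (simp add: g_def limI)
  qed
  ultimately show ?thesis
    using that r(1) by blast
qed

text \<open>Near-minimisers of the L2 norm over the sets \<open>K n\<close> form a Cauchy sequence by the
  parallelogram law; this replaces weak compactness.\<close>

lemma (in prob_space) decseq_midpoint_convex_AE_limit:
  assumes K: "\<And>n. K n \<subseteq> unit_funs M" "\<And>n. K n \<noteq> {}" "decseq K"
    and mid: "\<And>n f g. f \<in> K n \<Longrightarrow> g \<in> K n \<Longrightarrow> (\<lambda>x. (f x + g x) / 2) \<in> K n"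
  obtains f g where "\<And>n. f n \<in> K n" "g \<in> unit_funs M" "AE x in M. (\<lambda>n. f n x) \<longlonglongrightarrow> g x"
proof -
  define S where "S f = (\<integral>x. (f x)\<^sup>2 \<partial>M)" for f :: "'a \<Rightarrow> real"
  define e where "e n = inverse (real (Suc n))" for n
  have e_pos: "0 < e n" for n
    by (simp add: e_def)
  have e_mono: "e m \<le> e n" if "n \<le> m" for n m
    unfolding e_def using that by (intro le_imp_inverse_le) auto
  define a where "a n = Inf (S ` K n)" for n
  have S0: "0 \<le> S f" for f
    by (simp add: S_def)
  have bdd: "bdd_below (S ` A)" for A
    using S0 by (auto intro!: bdd_belowI[of _ 0])
  have "\<exists>f\<in>K n. S f < a n + e n" for n
    using cInf_lessD[of "S ` K n" "a n + e n"] K(2)[of n] e_pos[of n]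
    unfolding a_def by auto
  then obtain f where f: "\<And>n. f n \<in> K n" "\<And>n. S (f n) < a n + e n"
    by metis
  have fu: "f n \<in> unit_funs M" for n
    using f(1) K(1) by blast
  have a_le: "a n \<le> S h" if "h \<in> K n" for n h
    unfolding a_def using that bdd by (auto intro!: cInf_lower)
  have inc: "incseq a"
    unfolding a_def using K(2,3) bdd by (auto simp: incseq_def decseq_def intro!: cInf_superset_mono image_mono)
  have S1: "S h \<le> 1" if "h \<in> unit_funs M" for h
  proof -
    have "S h \<le> (\<integral>x. 1 \<partial>M)"
      unfolding S_def using that unit_funs_integrable_square[OF that]
      by (intro integral_mono) (auto simp: unit_funs_def power_le_one)
    then show ?thesis by (simp add: prob_space)
  qed
  have "a n \<le> 1" for n
    using a_le[OF f(1)] S1[OF fu] order_trans by blast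
  then obtain L where L: "a \<longlonglongrightarrow> L" "\<And>n. a n \<le> L"
    using incseq_convergent[OF inc] by blast
  \<comment> \<open>In the parallelogram law below the two norms are at most
    \<open>a i + e i\<close> and \<open>a j + e j\<close>, with \<open>a j \<le> L\<close> and
    \<open>e j \<le> e i\<close>. The midpoint lies in the larger set \<open>K i\<close>, so its
    norm is at least \<open>a i\<close>. Together this is
    \<open>2 * L - 2 * a i + 4 * e i\<close>.\<close>
  define d where "d n = 2 * L - 2 * a n + 4 * e n" for n
  have ad: "d m \<le> d n" if "n \<le> m" for n m
    using incseqD[OF inc that] e_mono[OF that] unfolding d_def by linarith
  have main: "(\<integral>x. (f i x - f j x)\<^sup>2 \<partial>M) \<le> d i" if "i \<le> j" for i j
  proof -
    have fj: "f j \<in> K i"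
      using f(1)[of j] K(3) that by (auto simp: decseq_def)
    define h where "h x = (f i x + f j x) / 2" for x
    have h: "h \<in> K i"
      unfolding h_def using mid[OF f(1) fj] .
    note int = unit_funs_integrable_square[OF fu[of i]] unit_funs_integrable_square[OF fu[of j]]
      unit_funs_integrable_square[of h]
    have "(\<integral>x. (f i x - f j x)\<^sup>2 \<partial>M) = (\<integral>x. 2 * (f i x)\<^sup>2 + 2 * (f j x)\<^sup>2 - 4 * (h x)\<^sup>2 \<partial>M)"
      by (intro Bochner_Integration.integral_cong) (auto simp: h_def power2_eq_square field_simps)
    also have "\<dots> = 2 * S (f i) + 2 * S (f j) - 4 * S h"
      unfolding S_def using int h K(1) by (subst Bochner_Integration.integral_diff) auto
    also have "\<dots> \<le> d i"
      using f(2)[of i] f(2)[of j] L(2)[of j] a_le[OF h] e_mono[OF that] unfolding d_def by linarith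
    finally show ?thesis .
  qed
  have d: "(\<integral>x. (f i x - f j x)\<^sup>2 \<partial>M) \<le> d N" if "N \<le> i" "N \<le> j" for N i j
    using main[of i j] main[of j i] ad[OF that(1)] ad[OF that(2)]
    by (cases "i \<le> j") (auto simp: power2_commute)
  have "d \<longlonglongrightarrow> 2 * L - 2 * L + 4 * 0"
    unfolding d_def e_def by (intro tendsto_intros L LIMSEQ_inverse_real_of_nat)
  then have "d \<longlonglongrightarrow> 0" by simp
  from integral_square_Cauchy_AE_limit[where f = f and d = d, OF fu d this]
  obtain r g where r: "strict_mono r" "g \<in> unit_funs M" "AE x in M. (\<lambda>n. f (r n) x) \<longlonglongrightarrow> g x"
    by blast
  \<comment> \<open>Since \<open>r n \<ge> n\<close> and \<open>K\<close> decreases, passing to the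
    subsequence keeps the n-th term in \<open>K n\<close>.\<close>
  have "f (r n) \<in> K n" for n
    using f(1)[of "r n"] K(3) seq_suble[OF r(1), of n] by (auto simp: decseq_def)
  with r show ?thesis
    by (intro that[of "\<lambda>n. f (r n)" g])
qed

section \<open>Covers and tilings of a measurable set in a finite power\<close>

text \<open>The duality is proved for any measurable \<open>F\<close> in the k-th power of the
  space; at the end \<open>F\<close> is taken to be the set of copies of the graph.\<close>

locale fractional_cover = prob_space M for M :: "'a measure" +
  fixes k :: nat and F :: "(nat \<Rightarrow> 'a) set"
  assumes F [measurable]: "F \<in> sets (PiOmega M {0..<k})"
begin

abbreviation P :: "(nat \<Rightarrow> 'a) measure" where
  "P \<equiv> PiOmega M {0..<k}"

definition marginal :: "((nat \<Rightarrow> 'a) \<Rightarrow> real) \<Rightarrow> 'a \<Rightarrow> ennreal" where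
  "marginal t x = (\<Sum>l<k. \<integral>\<^sup>+ y. ennreal (t (y(l := x))) \<partial>PiOmega M ({0..<k} - {l}))"

text \<open>The amount by which \<open>c\<close> fails the covering constraint at a point of
  \<open>F\<close>.\<close>

definition deficit :: "('a \<Rightarrow> real) \<Rightarrow> (nat \<Rightarrow> 'a) \<Rightarrow> real" where
  "deficit c x = indicator F x * max 0 (1 - (\<Sum>i<k. c (x i)))"

text \<open>Squaring makes the penalty differentiable in \<open>c\<close>, with a derivative linear
  in \<open>deficit c\<close>; this is how a tiling can be read off from a minimiser.\<close>

definition penalty :: "('a \<Rightarrow> real) \<Rightarrow> real" where
  "penalty c = (\<integral>x. (deficit c x)\<^sup>2 \<partial>P)"

definition tiling :: "((nat \<Rightarrow> 'a) \<Rightarrow> real) \<Rightarrow> bool" where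
  "tiling t \<longleftrightarrow> t \<in> borel_measurable P \<and> (\<forall>x\<in>space P. 0 \<le> t x)
     \<and> {x \<in> space P. t x \<noteq> 0} \<subseteq> F \<and> (\<forall>x\<in>space M. marginal t x \<le> 1)"

definition cover :: "('a \<Rightarrow> real) \<Rightarrow> bool" where
  "cover c \<longleftrightarrow> c \<in> unit_funs M \<and> emeasure P (F \<inter> {x. (\<Sum>i<k. c (x i)) < 1}) = 0"

sublocale P: prob_space P
  by (intro prob_space_PiM prob_space_axioms)

sublocale prod: product_sigma_finite "\<lambda>_::nat. M"
  by unfold_locales

lemma space_P_component: "x \<in> space P \<Longrightarrow> i < k \<Longrightarrow> x i \<in> space M"
  by (auto simp: space_PiM)

lemma measurable_component:
  assumes "f \<in> measurable M N" "i < k"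
  shows "(\<lambda>x. f (x i)) \<in> measurable P N"
  using assms by (intro measurable_compose[OF measurable_component_singleton]) auto

lemma measurable_sum_components [measurable]:
  fixes f :: "'a \<Rightarrow> 'b::{second_countable_topology, topological_comm_monoid_add}"
  assumes "f \<in> borel_measurable M"
  shows "(\<lambda>x. \<Sum>i<k. f (x i)) \<in> borel_measurable P"
  using assms by (intro borel_measurable_sum measurable_component) auto

lemma AE_components:
  assumes "AE x in M. Q x"
  shows "AE x in P. \<forall>i<k. Q (x i)"
proof -
  have "AE x in P. \<forall>i\<in>{0..<k}. Q (x i)"
    by (intro AE_finite_allI AE_PiM_component prob_space_axioms assms) auto
  then show ?thesis
    by eventually_elim auto
qed

lemma insert_component: "l < k \<Longrightarrow> insert l ({0..<k} - {l}) = {0..<k}"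
  by auto

lemma measurable_fun_upd_component:
  assumes "l < k"
  shows "(\<lambda>(x, y). y(l := x)) \<in> measurable (M \<Otimes>\<^sub>M PiOmega M ({0..<k} - {l})) P"
  unfolding case_prod_beta
  by (rule measurable_fun_upd[where J="{0..<k} - {l}"]) (use assms in auto)

lemma nn_integral_component:
  assumes "l < k" "f \<in> borel_measurable P"
  shows "(\<integral>\<^sup>+ x. f x \<partial>P) = (\<integral>\<^sup>+ x. \<integral>\<^sup>+ y. f (y(l := x)) \<partial>PiOmega M ({0..<k} - {l}) \<partial>M)"
  using prod.product_nn_integral_insert_rev[of "{0..<k} - {l}" l f] assms
  by (simp add: insert_component del: insert_Diff_single)

lemma sigma_finite_minus: "sigma_finite_measure (PiOmega M ({0..<k} - {l}))"
  by (intro prod.sigma_finite) auto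

lemma measurable_slice:
  assumes "l < k" "f \<in> borel_measurable P"
  shows "(\<lambda>(x, y). f (y(l := x))) \<in> borel_measurable (M \<Otimes>\<^sub>M PiOmega M ({0..<k} - {l}))"
  using measurable_compose[OF measurable_fun_upd_component[OF assms(1)] assms(2)]
  by (simp add: case_prod_beta')

lemma measurable_slice_integral:
  assumes "l < k" "t \<in> borel_measurable P"
  shows "(\<lambda>x. \<integral>\<^sup>+ y. ennreal (t (y(l := x))) \<partial>PiOmega M ({0..<k} - {l})) \<in> borel_measurable M"
  using assms measurable_slice[of l "\<lambda>x. ennreal (t x)"]
  by (intro sigma_finite_measure.borel_measurable_nn_integral[OF sigma_finite_minus]) auto

lemma measurable_marginal [measurable]:
  assumes "t \<in> borel_measurable P"
  shows "marginal t \<in> borel_measurable M"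
  unfolding marginal_def
  using assms by (intro borel_measurable_sum measurable_slice_integral) auto

text \<open>Tonelli, with the l-th coordinate singled out in the l-th summand. It makes
  \<open>marginal\<close> adjoint to the map from \<open>h\<close> to the sum of \<open>h\<close>
  over the coordinates. Weak duality uses it with \<open>h\<close> a cover, the marginal bound with
  \<open>h\<close> a test direction.\<close>

lemma nn_integral_marginal:
  assumes [measurable]: "t \<in> borel_measurable P" "h \<in> borel_measurable M"
  shows "(\<integral>\<^sup>+ x. ennreal (t x) * (\<Sum>i<k. h (x i)) \<partial>P) = (\<integral>\<^sup>+ x. h x * marginal t x \<partial>M)"
proof -
  have "(\<integral>\<^sup>+ x. ennreal (t x) * (\<Sum>i<k. h (x i)) \<partial>P)
      = (\<Sum>i<k. \<integral>\<^sup>+ x. ennreal (t x) * h (x i) \<partial>P)"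
    by (simp add: sum_distrib_left) (intro nn_integral_sum; simp)
  also have "\<dots> = (\<Sum>l<k. \<integral>\<^sup>+ x. h x *
      (\<integral>\<^sup>+ y. ennreal (t (y(l := x))) \<partial>PiOmega M ({0..<k} - {l})) \<partial>M)"
  proof (intro sum.cong refl)
    fix l assume l: "l \<in> {..<k}"
    then have [measurable]: "(\<lambda>y. ennreal (t (y(l := x)))) \<in> borel_measurable (PiOmega M ({0..<k} - {l}))"
      if "x \<in> space M" for x
      using measurable_Pair2[OF measurable_slice[of l "\<lambda>x. ennreal (t x)"] that] by simp
    have "(\<integral>\<^sup>+ x. ennreal (t x) * h (x l) \<partial>P)
      = (\<integral>\<^sup>+ x. \<integral>\<^sup>+ y. ennreal (t (y(l := x))) * h x \<partial>PiOmega M ({0..<k} - {l}) \<partial>M)"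
      using l by (subst nn_integral_component[of l]) auto
    also have "\<dots> = (\<integral>\<^sup>+ x. h x *
      (\<integral>\<^sup>+ y. ennreal (t (y(l := x))) \<partial>PiOmega M ({0..<k} - {l})) \<partial>M)"
      by (intro nn_integral_cong) (subst nn_integral_multc, auto simp: mult.commute)
    finally show "(\<integral>\<^sup>+ x. ennreal (t x) * h (x l) \<partial>P) = \<dots>" .
  qed
  also have "\<dots> = (\<integral>\<^sup>+ x. h x * marginal t x \<partial>M)"
    unfolding marginal_def sum_distrib_left
    by (subst nn_integral_sum) (auto intro!: borel_measurable_times_ennreal measurable_slice_integral)
  finally show ?thesis .
qed

section \<open>Weak duality\<close>

lemma weak_duality:
  assumes t: "tiling t" and c: "cover c"
  shows "(\<integral>\<^sup>+ x. t x \<partial>P) \<le> (\<integral>\<^sup>+ x. c x \<partial>M)"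
proof -
  have [measurable]: "t \<in> borel_measurable P" "c \<in> borel_measurable M"
    using t c by (auto simp: tiling_def cover_def unit_funs_def)
  have c01: "0 \<le> c x" if "x \<in> space M" for x
    using c that by (auto simp: cover_def unit_funs_def)
  have [measurable]: "F \<inter> {x. (\<Sum>i<k. c (x i)) < 1} \<in> sets P"
  proof -
    have "F \<inter> {x. (\<Sum>i<k. c (x i)) < 1} = F \<inter> {x \<in> space P. (\<Sum>i<k. c (x i)) < 1}"
      using sets.sets_into_space[OF F] by auto
    then show ?thesis by simp
  qed
  have "AE x in P. x \<notin> F \<inter> {x. (\<Sum>i<k. c (x i)) < 1}"
    using c by (intro AE_not_in) (auto simp: cover_def null_sets_def)
  \<comment> \<open>Off \<open>F\<close> the tiling vanishes; on \<open>F\<close> the cover sums to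
    at least 1 almost everywhere.\<close>
  then have "AE x in P. ennreal (t x) \<le> ennreal (t x) * (\<Sum>i<k. ennreal (c (x i)))"
    using AE_space
  proof eventually_elim
    case (elim x)
    have "(\<Sum>i<k. ennreal (c (x i))) = ennreal (\<Sum>i<k. c (x i))"
      using elim by (intro sum_ennreal c01 space_P_component) auto
    moreover have "t x = 0 \<or> 1 \<le> (\<Sum>i<k. c (x i))"
      using elim t by (auto simp: tiling_def)
    ultimately show ?case
      using mult_left_mono[of 1 "\<Sum>i<k. ennreal (c (x i))" "ennreal (t x)"] by auto
  qed
  then have "(\<integral>\<^sup>+ x. t x \<partial>P) \<le> (\<integral>\<^sup>+ x. ennreal (t x) * (\<Sum>i<k. ennreal (c (x i))) \<partial>P)"
    by (rule nn_integral_mono_AE)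
  also have "\<dots> = (\<integral>\<^sup>+ x. ennreal (c x) * marginal t x \<partial>M)"
    by (rule nn_integral_marginal) auto
  also have "\<dots> \<le> (\<integral>\<^sup>+ x. c x \<partial>M)"
  proof (intro nn_integral_mono)
    show "ennreal (c x) * marginal t x \<le> ennreal (c x)" if "x \<in> space M" for x
      using t that mult_left_mono[of "marginal t x" 1 "ennreal (c x)"] by (auto simp: tiling_def)
  qed
  finally show ?thesis .
qed

section \<open>Convexity and continuity of the penalty\<close>

lemma measurable_deficit [measurable]:
  "c \<in> borel_measurable M \<Longrightarrow> deficit c \<in> borel_measurable P"
  unfolding deficit_def
  by (intro borel_measurable_times borel_measurable_indicator F borel_measurable_max
      borel_measurable_diff borel_measurable_const measurable_sum_components)

lemma deficit_bounds:
  assumes "c \<in> unit_funs M" "x \<in> space P"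
  shows "0 \<le> deficit c x" "deficit c x \<le> 1"
proof -
  have "0 \<le> (\<Sum>i<k. c (x i))"
    using assms by (intro sum_nonneg unit_funsD(1)[of c M] space_P_component) auto
  then show "0 \<le> deficit c x" "deficit c x \<le> 1"
    by (auto simp: deficit_def indicator_def)
qed

lemma integrable_deficit_square:
  assumes "c \<in> unit_funs M"
  shows "integrable P (\<lambda>x. (deficit c x)\<^sup>2)"
  using assms deficit_bounds[OF assms]
  by (intro P.integrable_const_bound[where B=1] AE_I2)
     (auto simp: power_le_one unit_funs_measurable)

lemma penalty_nonneg: "0 \<le> penalty c"
  by (simp add: penalty_def)

text \<open>\<open>max 0 (1 - u)\<close> is convex in \<open>u\<close>, and squaring is convex and
  increasing on nonnegative reals.\<close>

lemma penalty_midpoint: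
  assumes "f \<in> unit_funs M" "g \<in> unit_funs M"
  shows "penalty (\<lambda>x. (f x + g x) / 2) \<le> (penalty f + penalty g) / 2"
proof -
  have "penalty (\<lambda>x. (f x + g x) / 2) \<le> (\<integral>x. ((deficit f x)\<^sup>2 + (deficit g x)\<^sup>2) / 2 \<partial>P)"
    unfolding penalty_def
  proof (intro integral_mono)
    fix x assume x: "x \<in> space P"
    have max: "max 0 (1 - m) \<le> (max 0 (1 - a) + max 0 (1 - b)) / 2" if "m = (a + b) / 2" for m a b :: real
      using that by (simp add: max_def)
    have "(\<Sum>i<k. (f (x i) + g (x i)) / 2) = ((\<Sum>i<k. f (x i)) + (\<Sum>i<k. g (x i))) / 2"
      by (simp add: sum.distrib sum_divide_distrib[symmetric])
    from max[OF this] have "deficit (\<lambda>x. (f x + g x) / 2) x \<le> (deficit f x + deficit g x) / 2"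
      by (simp add: deficit_def indicator_def)
    then have "(deficit (\<lambda>x. (f x + g x) / 2) x)\<^sup>2 \<le> ((deficit f x + deficit g x) / 2)\<^sup>2"
      using deficit_bounds(1)[OF unit_funs_midpoint[OF assms] x] by (intro power_mono)
    also have "\<dots> \<le> ((deficit f x)\<^sup>2 + (deficit g x)\<^sup>2) / 2"
      using zero_le_power2[of "deficit f x - deficit g x"]
      by (simp add: power2_eq_square field_simps)
    finally show "(deficit (\<lambda>x. (f x + g x) / 2) x)\<^sup>2 \<le> ((deficit f x)\<^sup>2 + (deficit g x)\<^sup>2) / 2" .
  qed (use assms integrable_deficit_square unit_funs_midpoint in auto)
  also have "\<dots> = (penalty f + penalty g) / 2"
    unfolding penalty_def using assms integrable_deficit_square by simp
  finally show ?thesis .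
qed

lemma tendsto_integral_unit_funs:
  assumes f: "\<And>n. f n \<in> unit_funs M" and g: "g \<in> unit_funs M"
    and lim: "AE x in M. (\<lambda>n. f n x) \<longlonglongrightarrow> g x"
  shows "(\<lambda>n. \<integral>x. f n x \<partial>M) \<longlonglongrightarrow> (\<integral>x. g x \<partial>M)"
  using f g lim
  by (intro integral_dominated_convergence[where w="\<lambda>_. 1"]) (auto simp: unit_funs_def)

text \<open>Convergence almost everywhere in \<open>M\<close> gives convergence in every coordinate
  almost everywhere in \<open>P\<close>, and squared deficits are bounded by 1, so dominated
  convergence applies.\<close>

lemma tendsto_penalty:
  assumes f: "\<And>n. f n \<in> unit_funs M" and g: "g \<in> unit_funs M"
    and lim: "AE x in M. (\<lambda>n. f n x) \<longlonglongrightarrow> g x"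
  shows "(\<lambda>n. penalty (f n)) \<longlonglongrightarrow> penalty g"
  unfolding penalty_def
proof (intro integral_dominated_convergence[where w="\<lambda>_. 1"])
  show "AE x in P. (\<lambda>n. (deficit (f n) x)\<^sup>2) \<longlonglongrightarrow> (deficit g x)\<^sup>2"
    using AE_components[OF lim]
    by eventually_elim (auto simp: deficit_def intro!: tendsto_intros)
  show "AE x in P. norm ((deficit (f n) x)\<^sup>2) \<le> 1" for n
    using deficit_bounds[OF f[of n]] by (intro AE_I2) (auto simp: power_le_one)
qed (use f g in \<open>auto simp: unit_funs_measurable\<close>)

lemma penalty_eq_0_imp_cover:
  assumes c: "c \<in> unit_funs M" and "penalty c = 0"
  shows "cover c"
proof -
  have [measurable]: "c \<in> borel_measurable M"
    using c by measurable
  have "AE x in P. (deficit c x)\<^sup>2 = 0"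
    using integral_nonneg_eq_0_iff_AE[OF integrable_deficit_square[OF c]] assms(2)
    by (simp add: penalty_def)
  then have "AE x in P. x \<notin> F \<inter> {x. (\<Sum>i<k. c (x i)) < 1}"
    by eventually_elim (auto simp: deficit_def max_def split: if_splits)
  moreover have eq: "F \<inter> {x. (\<Sum>i<k. c (x i)) < 1} = {x \<in> space P. x \<in> F \<inter> {x. (\<Sum>i<k. c (x i)) < 1}}"
    using sets.sets_into_space[OF F] by auto
  moreover have "{x \<in> space P. x \<in> F \<inter> {x. (\<Sum>i<k. c (x i)) < 1}} \<in> sets P"
    unfolding Int_iff mem_Collect_eq by measurable
  ultimately have "emeasure P (F \<inter> {x. (\<Sum>i<k. c (x i)) < 1}) = 0"
    using AE_iff_measurable[of "F \<inter> {x. (\<Sum>i<k. c (x i)) < 1}" P] by auto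
  with c show ?thesis
    by (simp add: cover_def)
qed

section \<open>Existence of a minimiser of the penalised size\<close>

text \<open>The sublevel sets of the objective just above its infimum are nonempty, decreasing and
  closed under midpoints. Hence some sequence of near-minimisers converges almost everywhere, and
  the objective is continuous along it.\<close>

lemma penalised_minimiser_exists:
  fixes n :: real
  assumes n: "0 \<le> n"
  obtains c where "c \<in> unit_funs M"
    "\<And>f. f \<in> unit_funs M \<Longrightarrow> (\<integral>x. c x \<partial>M) + n * penalty c \<le> (\<integral>x. f x \<partial>M) + n * penalty f"
proof -
  define J where "J f = (\<integral>x. f x \<partial>M) + n * penalty f" for f
  define m where "m = Inf (J ` unit_funs M)"
  define K where "K j = {f \<in> unit_funs M. J f \<le> m + inverse (real (Suc j))}" for j
  have J0: "0 \<le> J f" if "f \<in> unit_funs M" for f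
    unfolding J_def using that n penalty_nonneg
    by (intro add_nonneg_nonneg integral_nonneg_AE AE_I2) (auto simp: unit_funs_def)
  have bdd: "bdd_below (J ` unit_funs M)"
    using J0 by (auto intro!: bdd_belowI[of _ 0])
  have J_mid: "J (\<lambda>x. (f x + g x) / 2) \<le> (J f + J g) / 2"
    if fg: "f \<in> unit_funs M" "g \<in> unit_funs M" for f g
  proof -
    have "(\<integral>x. (f x + g x) / 2 \<partial>M) = ((\<integral>x. f x \<partial>M) + (\<integral>x. g x \<partial>M)) / 2"
      using fg[THEN unit_funs_integrable] by simp
    moreover have "n * penalty (\<lambda>x. (f x + g x) / 2) \<le> n * ((penalty f + penalty g) / 2)"
      using penalty_midpoint[OF fg] n by (rule mult_left_mono)
    ultimately show ?thesis
      unfolding J_def by (simp add: field_simps)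
  qed
  have "unit_funs M \<noteq> {}"
    by (auto simp: unit_funs_def intro!: exI[of _ "\<lambda>_. 0"])
  then have ne: "K j \<noteq> {}" for j
    using cInf_lessD[of "J ` unit_funs M" "m + inverse (real (Suc j))"]
    unfolding m_def K_def by (force simp: less_imp_le)
  have dec: "decseq K"
  proof (intro decseq_SucI subsetI)
    fix j f assume "f \<in> K (Suc j)"
    moreover have "inverse (real (Suc (Suc j))) \<le> inverse (real (Suc j))"
      by (intro le_imp_inverse_le) auto
    ultimately show "f \<in> K j"
      unfolding K_def mem_Collect_eq by (elim conjE, intro conjI; (assumption | linarith))
  qed
  have sub: "K j \<subseteq> unit_funs M" for j
    by (auto simp: K_def)
  have mid: "(\<lambda>x. (f x + g x) / 2) \<in> K j" if "f \<in> K j" "g \<in> K j" for f g j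
    using that J_mid[of f g] unit_funs_midpoint[of f M g] unfolding K_def by auto
  obtain f c where f: "\<And>j. f j \<in> K j" and c: "c \<in> unit_funs M"
    and lim: "AE x in M. (\<lambda>j. f j x) \<longlonglongrightarrow> c x"
    using decseq_midpoint_convex_AE_limit[OF sub ne dec mid] by metis
  have fu: "f j \<in> unit_funs M" for j
    using f sub by blast
  have "(\<lambda>j. J (f j)) \<longlonglongrightarrow> J c"
    unfolding J_def
    by (intro tendsto_intros tendsto_integral_unit_funs tendsto_penalty fu c lim)
  moreover have "(\<lambda>j. m + inverse (real (Suc j))) \<longlonglongrightarrow> m"
    using tendsto_add[OF tendsto_const LIMSEQ_inverse_real_of_nat, of m] by simp
  moreover have "J (f j) \<le> m + inverse (real (Suc j))" for j
    using f[of j] by (simp add: K_def)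
  ultimately have "J c \<le> m"
    by (intro LIMSEQ_le) auto
  then have "J c \<le> J h" if "h \<in> unit_funs M" for h
    using cInf_lower[OF _ bdd, of "J h"] that unfolding m_def by fastforce
  then show ?thesis
    using that c unfolding J_def by blast
qed

section \<open>First-order conditions and the tiling of a minimiser\<close>

lemma integrable_deficit_sum:
  assumes c: "c \<in> unit_funs M" and h [measurable]: "h \<in> borel_measurable M"
    and h1: "\<And>x. x \<in> space M \<Longrightarrow> \<bar>h x\<bar> \<le> 1"
  shows "integrable P (\<lambda>x. deficit c x * (\<Sum>i<k. h (x i)))"
proof (intro P.integrable_const_bound[where B="real k"] AE_I2)
  fix x assume x: "x \<in> space P"
  have "\<bar>\<Sum>i<k. h (x i)\<bar> \<le> (\<Sum>i<k. 1)"
    using x by (intro order_trans[OF sum_abs] sum_mono h1 space_P_component) auto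
  then show "norm (deficit c x * (\<Sum>i<k. h (x i))) \<le> real k"
    using deficit_bounds[OF c x] mult_mono[of "\<bar>deficit c x\<bar>" 1 "\<bar>\<Sum>i<k. h (x i)\<bar>" "real k"]
    by (simp add: abs_mult)
qed (use c in \<open>auto simp: unit_funs_measurable\<close>)

text \<open>The pointwise bound \<open>max 0 (a - b) \<le> \<bar>max 0 a - b\<bar>\<close>, once squared, bounds the penalty
  from above by its linearisation plus a quadratic error.\<close>

lemma penalty_perturb_le:
  assumes c: "c \<in> unit_funs M" and h [measurable]: "h \<in> borel_measurable M"
    and h1: "\<And>x. x \<in> space M \<Longrightarrow> \<bar>h x\<bar> \<le> 1"
    and u: "(\<lambda>x. c x + s * h x) \<in> unit_funs M"
  shows "penalty (\<lambda>x. c x + s * h x)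
    \<le> penalty c - 2 * s * (\<integral>x. deficit c x * (\<Sum>i<k. h (x i)) \<partial>P) + s\<^sup>2 * (real k)\<^sup>2"
proof -
  have "penalty (\<lambda>x. c x + s * h x)
     \<le> (\<integral>x. (deficit c x)\<^sup>2 - 2 * s * (deficit c x * (\<Sum>i<k. h (x i))) + s\<^sup>2 * (real k)\<^sup>2 \<partial>P)"
    unfolding penalty_def
  proof (intro integral_mono)
    fix x assume x: "x \<in> space P"
    define b where "b = s * (\<Sum>i<k. h (x i))"
    have "\<bar>\<Sum>i<k. h (x i)\<bar> \<le> (\<Sum>i<k. 1)"
      using x by (intro order_trans[OF sum_abs] sum_mono h1 space_P_component) auto
    then have "(\<Sum>i<k. h (x i))\<^sup>2 \<le> (real k)\<^sup>2"
      by (intro abs_le_square_iff[THEN iffD1]) simp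
    then have b2: "b\<^sup>2 \<le> s\<^sup>2 * (real k)\<^sup>2"
      by (simp add: b_def power_mult_distrib mult_left_mono)
    have max: "(max 0 (a - b))\<^sup>2 \<le> (max 0 a)\<^sup>2 - 2 * (max 0 a * b) + b\<^sup>2" for a
    proof -
      have "\<bar>max 0 (a - b)\<bar> \<le> \<bar>max 0 a - b\<bar>"
        by (auto simp: max_def abs_if)
      then have "(max 0 (a - b))\<^sup>2 \<le> (max 0 a - b)\<^sup>2"
        by (rule abs_le_square_iff[THEN iffD1])
      then show ?thesis
        by (simp add: power2_diff)
    qed
    have "(\<Sum>i<k. c (x i) + s * h (x i)) = (\<Sum>i<k. c (x i)) + b"
      by (simp add: b_def sum.distrib sum_distrib_left)
    with max[of "1 - (\<Sum>i<k. c (x i))"] b2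
    show "(deficit (\<lambda>x. c x + s * h x) x)\<^sup>2
      \<le> (deficit c x)\<^sup>2 - 2 * s * (deficit c x * (\<Sum>i<k. h (x i))) + s\<^sup>2 * (real k)\<^sup>2"
      by (cases "x \<in> F") (auto simp: deficit_def b_def algebra_simps)
  qed (use integrable_deficit_square[OF u] integrable_deficit_square[OF c]
        integrable_deficit_sum[OF c h h1] in auto)
  also have "\<dots> = penalty c - 2 * s * (\<integral>x. deficit c x * (\<Sum>i<k. h (x i)) \<partial>P) + s\<^sup>2 * (real k)\<^sup>2"
    unfolding penalty_def
    using integrable_deficit_square[OF c] integrable_deficit_sum[OF c h h1]
    by (simp add: P.prob_space)
  finally show ?thesis .
qed

context
  fixes n :: real and c :: "'a \<Rightarrow> real"
  assumes n: "0 \<le> n" and c: "c \<in> unit_funs M"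
    and min: "\<And>f. f \<in> unit_funs M \<Longrightarrow>
      (\<integral>x. c x \<partial>M) + n * penalty c \<le> (\<integral>x. f x \<partial>M) + n * penalty f"
begin

text \<open>For \<open>0 < s \<le> 1\<close> the function \<open>c + s * h\<close> is a convex
  combination of \<open>c\<close> and \<open>c + h\<close>, so it competes with \<open>c\<close>.
  The linear upper bound on its penalty leaves an error of order \<open>s^2\<close>; dividing by
  \<open>s\<close> and letting \<open>s\<close> tend to 0 gives the claim. Only an inequality
  results, as \<open>c - h\<close> may leave [0,1].\<close>

lemma minimiser_first_order:
  assumes u: "(\<lambda>x. c x + h x) \<in> unit_funs M"
  shows "(\<integral>x. (2 * n * deficit c x) * (\<Sum>i<k. h (x i)) \<partial>P) \<le> (\<integral>x. h x \<partial>M)"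
proof -
  have [measurable]: "c \<in> borel_measurable M"
    using c by measurable
  have "(\<lambda>x. (c x + h x) - c x) \<in> borel_measurable M"
    using u[THEN unit_funs_measurable] by (intro borel_measurable_diff) auto
  then have h [measurable]: "h \<in> borel_measurable M"
    by simp
  have h1: "\<bar>h x\<bar> \<le> 1" if "x \<in> space M" for x
    using unit_funsD[OF c that] unit_funsD[OF u that] by linarith
  have inth: "integrable M h"
    using h1 by (intro integrable_const_bound[where B=1] AE_I2) auto
  define A where "A = (\<integral>x. deficit c x * (\<Sum>i<k. h (x i)) \<partial>P)"
  define B where "B = (\<integral>x. h x \<partial>M)"
  have "2 * n * A - B \<le> s * (n * (real k)\<^sup>2)" if s: "0 < s" "s \<le> 1" for s
  proof -
    have us: "(\<lambda>x. c x + s * h x) \<in> unit_funs M"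
    proof -
      have "0 \<le> c x + s * h x \<and> c x + s * h x \<le> 1" if x: "x \<in> space M" for x
      proof -
        have "c x + s * h x = (1 - s) * c x + s * (c x + h x)"
          by (simp add: algebra_simps)
        moreover have "(1 - s) * c x \<le> (1 - s) * 1" "s * (c x + h x) \<le> s * 1"
          "0 \<le> (1 - s) * c x" "0 \<le> s * (c x + h x)"
          using s unit_funsD[OF c x] unit_funsD[OF u x]
          by (intro mult_left_mono mult_nonneg_nonneg; simp)+
        ultimately show ?thesis by auto
      qed
      then show ?thesis
        by (auto simp: unit_funs_def)
    qed
    have "(\<integral>x. c x \<partial>M) + n * penalty c \<le> (\<integral>x. c x + s * h x \<partial>M) + n * penalty (\<lambda>x. c x + s * h x)"
      by (rule min[OF us])
    also have "\<dots> \<le> (\<integral>x. c x + s * h x \<partial>M) + n * (penalty c - 2 * s * A + s\<^sup>2 * (real k)\<^sup>2)"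
      using n penalty_perturb_le[OF c h h1 us] unfolding A_def
      by (intro add_left_mono mult_left_mono) auto
    also have "(\<integral>x. c x + s * h x \<partial>M) = (\<integral>x. c x \<partial>M) + s * B"
      using unit_funs_integrable[OF c] inth unfolding B_def by simp
    finally have "s * (2 * n * A - B) \<le> s * (s * (n * (real k)\<^sup>2))"
      by (simp add: algebra_simps power2_eq_square)
    then show ?thesis
      using s by simp
  qed
  then have ev: "\<forall>\<^sub>F s in at_right 0. 2 * n * A - B \<le> s * (n * (real k)\<^sup>2)"
    by (auto simp: eventually_at_right[of 0 1] intro!: exI[of _ 1])
  have "((\<lambda>s. s * (n * (real k)\<^sup>2)) \<longlongrightarrow> 0 * (n * (real k)\<^sup>2)) (at_right 0)"
    by (intro tendsto_intros)
  from tendsto_lowerbound[OF this ev] have "2 * n * A \<le> B"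
    by simp
  then show ?thesis
    by (simp add: A_def B_def mult.assoc)
qed

text \<open>Raise \<open>c\<close> to 1 wherever the marginal exceeds 1. For this direction
  \<open>h\<close> the first-order condition says that \<open>h * marginal\<close> integrates to at
  most the integral of \<open>h\<close>, yet it dominates \<open>h\<close> pointwise. So the two
  agree almost everywhere, which excludes a marginal above 1 where \<open>c < 1\<close>; where
  \<open>c = 1\<close> the marginal is 0.\<close>

lemma minimiser_marginal_le_1: "AE x in M. marginal (\<lambda>x. 2 * n * deficit c x) x \<le> 1"
proof -
  define t where "t x = 2 * n * deficit c x" for x
  define h where "h x = (1 - c x) * indicator {x. 1 < marginal t x} x" for x
  have [measurable]: "c \<in> borel_measurable M"
    using c by measurable
  then have [measurable]: "t \<in> borel_measurable P"
    unfolding t_def by measurable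
  have hm [measurable]: "h \<in> borel_measurable M"
    unfolding h_def by measurable
  have h01: "0 \<le> h x" "h x \<le> 1" if "x \<in> space M" for x
    using unit_funsD[OF c that] by (auto simp: h_def indicator_def)
  have t0: "0 \<le> t x" if "x \<in> space P" for x
    using n deficit_bounds[OF c that] by (simp add: t_def)
  have "(\<lambda>x. c x + h x) \<in> unit_funs M"
    using unit_funsD[OF c] by (auto simp: unit_funs_def h_def indicator_def)
  from minimiser_first_order[OF this]
  have le: "(\<integral>x. t x * (\<Sum>i<k. h (x i)) \<partial>P) \<le> (\<integral>x. h x \<partial>M)"
    by (simp add: t_def)
  have sum0: "0 \<le> (\<Sum>i<k. h (x i))" if "x \<in> space P" for x
    using that by (intro sum_nonneg h01 space_P_component) auto
  have "integrable P (\<lambda>x. t x * (\<Sum>i<k. h (x i)))"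
    using integrable_deficit_sum[OF c hm] h01 by (simp add: t_def mult.assoc)
  then have "(\<integral>\<^sup>+ x. ennreal (t x * (\<Sum>i<k. h (x i))) \<partial>P) = ennreal (\<integral>x. t x * (\<Sum>i<k. h (x i)) \<partial>P)"
    using t0 sum0 by (intro nn_integral_eq_integral) auto
  also have "\<dots> \<le> ennreal (\<integral>x. h x \<partial>M)"
    using le by (rule ennreal_leI)
  also have "\<dots> = (\<integral>\<^sup>+ x. h x \<partial>M)"
    using h01 by (intro nn_integral_eq_integral[symmetric] integrable_const_bound[where B=1] AE_I2) auto
  finally have 1: "(\<integral>\<^sup>+ x. ennreal (t x * (\<Sum>i<k. h (x i))) \<partial>P) \<le> (\<integral>\<^sup>+ x. h x \<partial>M)" .
  have "(\<integral>\<^sup>+ x. ennreal (h x) * marginal t x \<partial>M) = (\<integral>\<^sup>+ x. ennreal (t x) * (\<Sum>i<k. ennreal (h (x i))) \<partial>P)"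
    by (rule nn_integral_marginal[symmetric]) auto
  also have "\<dots> = (\<integral>\<^sup>+ x. ennreal (t x * (\<Sum>i<k. h (x i))) \<partial>P)"
  proof (intro nn_integral_cong)
    fix x assume x: "x \<in> space P"
    have "(\<Sum>i<k. ennreal (h (x i))) = ennreal (\<Sum>i<k. h (x i))"
      using x by (intro sum_ennreal h01 space_P_component) auto
    then show "ennreal (t x) * (\<Sum>i<k. ennreal (h (x i))) = ennreal (t x * (\<Sum>i<k. h (x i)))"
      using t0[OF x] sum0[OF x] by (simp add: ennreal_mult)
  qed
  finally have 2: "(\<integral>\<^sup>+ x. ennreal (h x) * marginal t x \<partial>M) \<le> (\<integral>\<^sup>+ x. h x \<partial>M)"
    using 1 by simp
  have "(\<integral>\<^sup>+ x. h x \<partial>M) \<le> (\<integral>\<^sup>+ x. 1 \<partial>M)"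
    using h01 by (intro nn_integral_mono) simp
  \<comment> \<open>Finiteness is needed to turn a strict inequality on a non-null set into one
    between the integrals.\<close>
  then have fin: "(\<integral>\<^sup>+ x. h x \<partial>M) \<noteq> \<infinity>"
    by (auto simp: emeasure_space_1 top_unique)
  have ge: "AE x in M. ennreal (h x) \<le> ennreal (h x) * marginal t x"
  proof (rule AE_I2)
    show "ennreal (h x) \<le> ennreal (h x) * marginal t x" for x
      using mult_left_mono[of 1 "marginal t x" "ennreal (h x)"]
      by (cases "1 < marginal t x") (auto simp: h_def)
  qed
  have "AE x in M. ennreal (h x) * marginal t x \<le> ennreal (h x)"
  proof (rule ccontr)
    assume "\<not> ?thesis"
    then have "(\<integral>\<^sup>+ x. h x \<partial>M) < (\<integral>\<^sup>+ x. ennreal (h x) * marginal t x \<partial>M)"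
      using ge fin by (intro nn_integral_less) auto
    with 2 show False by simp
  qed
  then have "AE x in M. marginal t x \<le> 1"
    using AE_space
  proof eventually_elim
    case (elim x)
    show ?case
    proof (cases "c x = 1")
      case True
      \<comment> \<open>A coordinate with \<open>c = 1\<close> meets the covering constraint alone,
        so the deficit vanishes on the whole slice.\<close>
      have "t (y(l := x)) = 0" if l: "l < k" and y: "y \<in> space (PiOmega M ({0..<k} - {l}))" for l y
      proof -
        have "c ((y(l := x)) l) \<le> (\<Sum>i<k. c ((y(l := x)) i))"
          using l y elim(2) by (intro member_le_sum unit_funsD(1)[OF c]) (auto simp: space_PiM PiE_iff)
        then show ?thesis
          using True by (simp add: t_def deficit_def)
      qed
      then have "marginal t x = 0"
        unfolding marginal_def by (auto intro!: sum.neutral simp: nn_integral_cong[where v="\<lambda>_. 0"])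
      then show ?thesis by simp
    next
      case False
      then have c1: "c x < 1"
        using unit_funsD[OF c elim(2)] by simp
      show ?thesis
      proof (rule ccontr)
        assume not: "\<not> marginal t x \<le> 1"
        then have "0 < h x"
          using c1 by (simp add: h_def)
        then show False
          using elim(1) not ennreal_mult_le_mult_iff[of "ennreal (h x)" "marginal t x" 1] by simp
      qed
    qed
  qed
  then show ?thesis
    by (simp add: t_def[abs_def])
qed

lemma minimiser_le_tiling:
  obtains t where "tiling t" "(\<integral>\<^sup>+ x. c x \<partial>M) \<le> (\<integral>\<^sup>+ x. t x \<partial>P)"
proof -
  define t where "t x = 2 * n * deficit c x" for x
  define G where "G = {x. \<forall>i<k. marginal t (x i) \<le> 1}"
  \<comment> \<open>A tiling must satisfy the marginal bound at every point, not just almost every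
    one. Cutting \<open>t\<close> off when some coordinate is bad changes it on a null set only, and
    makes every slice through a bad point zero.\<close>
  define t' where "t' x = indicator G x * t x" for x
  have [measurable]: "c \<in> borel_measurable M"
    using c by measurable
  then have tm [measurable]: "t \<in> borel_measurable P"
    unfolding t_def by measurable
  have t0: "0 \<le> t x" if "x \<in> space P" for x
    using n deficit_bounds[OF c that] by (simp add: t_def)
  have "{x \<in> space P. \<forall>i\<in>{..<k}. marginal t (x i) \<le> 1} \<in> sets P"
    using measurable_component[OF measurable_marginal[OF tm]]
    by (intro sets.sets_Collect_finite_All) auto
  then have [measurable]: "t' \<in> borel_measurable P"
    unfolding t'_def G_def
    by (intro borel_measurable_times tm, subst borel_measurable_indicator_iff) (simp add: Int_def conj_commute)
  have AEG: "AE x in P. x \<in> G"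
    using AE_components[OF minimiser_marginal_le_1] by (simp add: G_def t_def[abs_def])
  have le: "marginal t' x \<le> 1" if x: "x \<in> space M" for x
  proof (cases "marginal t x \<le> 1")
    case True
    have "marginal t' x \<le> marginal t x"
      unfolding marginal_def
    proof (intro sum_mono nn_integral_mono ennreal_leI)
      fix l y assume "l \<in> {..<k}" "y \<in> space (PiOmega M ({0..<k} - {l}))"
      then have "y(l := x) \<in> space P"
        using x by (auto simp: space_PiM PiE_iff extensional_def)
      then show "t' (y(l := x)) \<le> t (y(l := x))"
        using t0 by (auto simp: t'_def indicator_def)
    qed
    with True show ?thesis by simp
  next
    case False
    then have "t' (y(l := x)) = 0" if "l < k" for l y
      using that by (auto simp: t'_def G_def indicator_def intro!: exI[of _ l])
    then show ?thesis
      by (simp add: marginal_def)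
  qed
  have tiling: "tiling t'"
    unfolding tiling_def using le t0
    by (auto simp: t'_def t_def deficit_def indicator_def split: if_splits)
  have int_c: "integrable P (\<lambda>x. t x * (\<Sum>i<k. c (x i)))"
    using integrable_deficit_sum[OF c, of c] unit_funsD[OF c] by (simp add: t_def mult.assoc)
  have int_t: "integrable P t"
    unfolding t_def using deficit_bounds[OF c]
    by (intro integrable_mult_right P.integrable_const_bound[where B=1] AE_I2) auto
  \<comment> \<open>The direction \<open>- c\<close>, lowering \<open>c\<close> to 0, bounds the
    size of \<open>c\<close> by the integral of \<open>t\<close> times the coordinate sum of
    \<open>c\<close>.\<close>
  have "(\<lambda>x. c x + - c x) \<in> unit_funs M"
    by (simp add: unit_funs_def)
  from minimiser_first_order[OF this]
  have "(\<integral>x. c x \<partial>M) \<le> (\<integral>x. t x * (\<Sum>i<k. c (x i)) \<partial>P)"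
    by (simp add: t_def sum_negf)
  also have "\<dots> \<le> (\<integral>x. t x \<partial>P)"
  proof (rule integral_mono[OF int_c int_t])
    fix x assume x: "x \<in> space P"
    \<comment> \<open>Complementary slackness: \<open>t\<close> vanishes wherever the coordinate sum
      exceeds 1.\<close>
    show "t x * (\<Sum>i<k. c (x i)) \<le> t x"
    proof (cases "(\<Sum>i<k. c (x i)) \<le> 1")
      case True
      then show ?thesis
        using mult_left_mono[OF True t0[OF x]] by simp
    qed (simp add: t_def deficit_def)
  qed
  finally have "ennreal (\<integral>x. c x \<partial>M) \<le> ennreal (\<integral>x. t x \<partial>P)"
    by (rule ennreal_leI)
  also have "\<dots> = (\<integral>\<^sup>+ x. t x \<partial>P)"
    using t0 by (intro nn_integral_eq_integral[symmetric] int_t) auto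
  also have "\<dots> = (\<integral>\<^sup>+ x. t' x \<partial>P)"
    using AEG by (intro nn_integral_cong_AE) (auto simp: t'_def)
  also have "ennreal (\<integral>x. c x \<partial>M) = (\<integral>\<^sup>+ x. c x \<partial>M)"
    using unit_funsD[OF c] by (intro nn_integral_eq_integral[symmetric] unit_funs_integrable[OF c]) auto
  finally show ?thesis
    using that tiling by blast
qed

end

section \<open>Strong duality by letting the penalty weight grow\<close>

text \<open>The minimiser for weight \<open>Suc n\<close> is no larger than some tiling, hence of
  size at most \<open>s\<close>, and it has penalty at most \<open>1/(n+1)\<close>. These two bounds
  cut out decreasing midpoint-closed sets, so an almost everywhere limit exists; it has penalty 0
  and size at most \<open>s\<close>.\<close>

lemma strong_duality:
  assumes k: "0 < k" and s: "0 \<le> s"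
    and le: "\<And>t. tiling t \<Longrightarrow> (\<integral>\<^sup>+ x. t x \<partial>P) \<le> ennreal s"
  obtains c where "cover c" "(\<integral>\<^sup>+ x. c x \<partial>M) \<le> ennreal s"
proof -
  define K where "K n = {c \<in> unit_funs M. (\<integral>x. c x \<partial>M) \<le> s \<and> penalty c \<le> inverse (real (Suc n))}" for n
  have sub: "K n \<subseteq> unit_funs M" for n
    by (auto simp: K_def)
  have dec: "decseq K"
  proof (intro decseq_SucI subsetI)
    fix n f assume "f \<in> K (Suc n)"
    moreover have "inverse (real (Suc (Suc n))) \<le> inverse (real (Suc n))"
      by (intro le_imp_inverse_le) auto
    ultimately show "f \<in> K n"
      unfolding K_def mem_Collect_eq by (elim conjE, intro conjI; (assumption | linarith))
  qed
  have mid: "(\<lambda>x. (f x + g x) / 2) \<in> K n" if "f \<in> K n" "g \<in> K n" for f g n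
  proof -
    have fg: "f \<in> unit_funs M" "g \<in> unit_funs M"
      using that by (auto simp: K_def)
    have "(\<integral>x. (f x + g x) / 2 \<partial>M) = ((\<integral>x. f x \<partial>M) + (\<integral>x. g x \<partial>M)) / 2"
      using fg[THEN unit_funs_integrable] by simp
    with penalty_midpoint[OF fg] that unit_funs_midpoint[OF fg] show ?thesis
      unfolding K_def by auto
  qed
  have ne: "K n \<noteq> {}" for n
  proof -
    obtain c where c: "c \<in> unit_funs M"
      and min: "\<And>f. f \<in> unit_funs M \<Longrightarrow>
        (\<integral>x. c x \<partial>M) + real (Suc n) * penalty c \<le> (\<integral>x. f x \<partial>M) + real (Suc n) * penalty f"
      using penalised_minimiser_exists[of "real (Suc n)"] by auto
    obtain t where "tiling t" "(\<integral>\<^sup>+ x. c x \<partial>M) \<le> (\<integral>\<^sup>+ x. t x \<partial>P)"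
      using minimiser_le_tiling[OF _ c min] by auto
    with le have "(\<integral>\<^sup>+ x. c x \<partial>M) \<le> ennreal s"
      by (blast intro: order_trans)
    moreover have "(\<integral>\<^sup>+ x. c x \<partial>M) = ennreal (\<integral>x. c x \<partial>M)"
      using unit_funsD[OF c] by (intro nn_integral_eq_integral unit_funs_integrable[OF c]) auto
    ultimately have "(\<integral>x. c x \<partial>M) \<le> s"
      using s by simp
    moreover have "penalty c \<le> inverse (real (Suc n))"
    proof -
      \<comment> \<open>The constant 1 is the competitor: as \<open>0 < k\<close> it has penalty 0,
        and its size 1 bounds the minimum for every weight.\<close>
      have "deficit (\<lambda>_. 1) = (\<lambda>_. 0)"
        using k by (auto simp: deficit_def fun_eq_iff)
      then have "penalty (\<lambda>_. 1) = 0"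
        by (simp add: penalty_def)
      moreover have "(\<lambda>_. 1) \<in> unit_funs M"
        by (simp add: unit_funs_def)
      ultimately have "(\<integral>x. c x \<partial>M) + real (Suc n) * penalty c \<le> 1"
        using min[of "\<lambda>_. 1"] by (simp add: prob_space)
      moreover have "0 \<le> (\<integral>x. c x \<partial>M)"
        using unit_funsD[OF c] by (intro integral_nonneg_AE) auto
      ultimately have "real (Suc n) * penalty c \<le> 1"
        by linarith
      then show ?thesis
        by (simp add: field_simps)
    qed
    ultimately show ?thesis
      using c by (auto simp: K_def)
  qed
  obtain f c where f: "\<And>n. f n \<in> K n" and c: "c \<in> unit_funs M"
    and lim: "AE x in M. (\<lambda>n. f n x) \<longlonglongrightarrow> c x"
    using decseq_midpoint_convex_AE_limit[OF sub ne dec mid] by metis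
  have fu: "f n \<in> unit_funs M" for n
    using f sub by blast
  have "penalty c \<le> 0"
    using tendsto_penalty[OF fu c lim] LIMSEQ_inverse_real_of_nat
    by (rule LIMSEQ_le) (use f in \<open>auto simp: K_def\<close>)
  then have "cover c"
    using penalty_nonneg[of c] by (intro penalty_eq_0_imp_cover c) auto
  moreover have "(\<integral>x. c x \<partial>M) \<le> s"
    using tendsto_integral_unit_funs[OF fu c lim]
    by (rule LIMSEQ_le_const2) (use f in \<open>auto simp: K_def\<close>)
  then have "(\<integral>\<^sup>+ x. c x \<partial>M) \<le> ennreal s"
    using unit_funsD[OF c]
    by (subst nn_integral_eq_integral) (auto intro!: unit_funs_integrable[OF c] ennreal_leI)
  ultimately show ?thesis
    using that by blast
qed

lemma duality:
  assumes k: "0 < k"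
  shows "(SUP t\<in>Collect tiling. \<integral>\<^sup>+ x. t x \<partial>P) = (INF c\<in>Collect cover. \<integral>\<^sup>+ x. c x \<partial>M)"
    (is "?L = ?R")
proof (rule antisym)
  show "?L \<le> ?R"
    using weak_duality by (intro SUP_least INF_greatest) auto
  show "?R \<le> ?L"
  \<comment> \<open>A finite supremum itself serves as the bound \<open>s\<close>; an infinite one
    leaves nothing to prove.\<close>
  proof (cases ?L)
    case (real s)
    then have "(\<integral>\<^sup>+ x. t x \<partial>P) \<le> ennreal s" if "tiling t" for t
      using that SUP_upper[of t "Collect tiling" "\<lambda>t. \<integral>\<^sup>+ x. t x \<partial>P"] by simp
    from strong_duality[OF k real(1) this] obtain c where "cover c" "(\<integral>\<^sup>+ x. c x \<partial>M) \<le> ennreal s"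
      by blast
    then show ?thesis
      unfolding real(2) by (auto intro: INF_lower2)
  next
    case top
    show ?thesis
      unfolding top by simp
  qed
qed

end

section \<open>Application to copies of a graph in a graphon\<close>

lemma copy_set_measurable:
  assumes W: "(\<lambda>(x, y). W x y) \<in> borel_measurable (M \<Otimes>\<^sub>M M)"
    and E: "E \<subseteq> {0..<k} \<times> {0..<k}"
  shows "copy_set M k E W \<in> sets (PiOmega M {0..<k})"
proof -
  have "(\<lambda>x. W (x i) (x j)) \<in> borel_measurable (PiOmega M {0..<k})" if "(i, j) \<in> E" for i j
  proof -
    have "(\<lambda>x. (x i, x j)) \<in> measurable (PiOmega M {0..<k}) (M \<Otimes>\<^sub>M M)"
      using that E by (intro measurable_Pair measurable_component_singleton) auto
    from measurable_compose[OF this W] show ?thesis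
      by simp
  qed
  then have [measurable]: "homprod k E W \<in> borel_measurable (PiOmega M {0..<k})"
    unfolding homprod_def[abs_def] by (intro borel_measurable_prod) auto
  show ?thesis
    unfolding copy_set_def by measurable
qed

theorem theorem3p16:
  fixes M :: "'a::polish_space measure"
    and W :: "'a \<Rightarrow> 'a \<Rightarrow> real"
    and k :: nat and E :: "(nat \<times> nat) set"
  assumes "prob_space M" and "sets M = sets borel" and "atomless M"
    and "graphon M W"
    and "0 < k" and "simple_graph k E"
  shows "til M k E W = fcov M k E W"
proof -
  have "copy_set M k E W \<in> sets (PiOmega M {0..<k})"
    using assms by (intro copy_set_measurable) (auto simp: graphon_def simple_graph_def)
  then interpret fractional_cover M k "copy_set M k E W"
    using assms(1) by (simp add: fractional_cover_def fractional_cover_axioms_def)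
  have "is_tiling M k E W = tiling" "is_fcover M k E W = cover"
    by (auto simp: fun_eq_iff is_tiling_def tiling_def marginal_def is_fcover_def cover_def unit_funs_def)
  then show ?thesis
    using duality[OF assms(5)] by (simp add: til_def fcov_def)
qed

end
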